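(* Suppose that the critical exponents $\beta$, $\eta$, $\nu$ and $\gamma$ exist for independent site percolation on $\mathbb{Z}^2_{cp}$, that is, suppose that the following limits exist: $$\lim_{p\downarrow p_c^*}\frac{\log\theta(p)}{\log(p-p_c^* )}=\beta,\quad \lim_{\|x\|\to\infty}\frac{\log\tau_{p_c^*}(x)}{\log\|x\|}=-\eta,\quad \lim_{p\uparrow p_c^*}\frac{\log\xi(p)}{\log(p_c^*-p)}=-\nu,\quad \lim_{p\uparrow p_c^*}\frac{\log\chi(p)}{\log(p_c^*-p)}=-\gamma.$$ Then they also exist for the bootstrapped model and have for the latter the same numerical values as for the original model, that is, $$\lim_{p\downarrow p_c^*}\frac{\log\theta(p,\infty)}{\log(p-p_c^* )}=\beta,\quad \lim_{\|x\|\to\infty}\frac{\log\tau_{p_c^*,\infty}(x)}{\log\|x\|}=-\eta,\quad \lim_{p\uparrow p_c^*}\frac{\log\xi(p,\infty)}{\log(p_c^*-p)}=-\nu,\quad \lim_{p\uparrow p_c^*}\frac{\log\chi(p,\infty)}{\log(p_c^*-p)}=-\gamma.$$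
   Context: Two sites of $\mathbb{Z}^2$ are neighbors if they are at Euclidean distance $1$. The initial configuration $\omega=\omega_0\in\{0,1\}^{\mathbb{Z}^2}$ is chosen according to $P_p$, the product of Bernoulli measures with parameter $p$ (each site is independently $1$ with probability $p$); $E_p$ is the corresponding expectation. The bootstrap dynamics is deterministic, in discrete time, with simultaneous updates: $1$'s remain $1$ forever, and a $0$ becomes $1$ at the next update if and only if it has at least three neighbors (out of four) that are $1$. $\omega_n$ is the configuration after $n$ updates and $\omega_\infty=\bar\omega=\lim_n\omega_n$ is the final (bootstrapped) configuration (the limit exists by monotonicity). Sites with value $1$ are called open. $\mathbb{Z}^2_{cp}$ is the close-packed version of $\mathbb{Z}^2$, obtained by adding the two diagonals to each face of $\mathbb{Z}^2$ (so each site has eight neighbors). $p_c^*$ is the critical value of independent site percolation on $\mathbb{Z}^2_{cp}$; it equals $1-p_c$, where $p_c$ is the critical value of independent site percolation on $\mathbb{Z}^2$. Open clusters here are connected components of open sites in $\mathbb{Z}^2_{cp}$. For independent site percolation on $\mathbb{Z}^2_{cp}$ (i.e. for $\omega_0$): with $C_o$ the open cluster containing the origin $o$, $\theta(p)=P_p(|C_o|=\infty)$ is the percolation probability; $\tau_p(x)=P_p(o\text{ and }x\text{ belong to the same open cluster})$ is the connectivity function; the correlation length $\xi(p)$ is defined by $\xi(p)^{-1}=\lim_{\|x\|\to\infty}\left\{-\frac{1}{\|x\|}\log\tau_p(x)\right\}$, where $\|x\|$ is the Euclidean norm (existence of this limit is presupposed for the independent model); $\chi(p)=E_p|C_o|$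 is the mean cluster size. $\theta(p,\infty)$, $\tau_{p,\infty}(x)$, $\xi(p,\infty)$, $\chi(p,\infty)$ denote the same quantities defined with the bootstrapped configuration $\bar\omega$ in place of $\omega_0$ (again with open clusters in $\mathbb{Z}^2_{cp}$). *)

theory Defs
  imports "HOL-Probability.Probability"
begin

section \<open>Sites and lattices\<close>

type_synonym site = "int \<times> int"
type_synonym config = "site \<Rightarrow> bool"

definition embed :: "site \<Rightarrow> real \<times> real" where
  "embed x = (real_of_int (fst x), real_of_int (snd x))"

text \<open>The norm on \<^typ>\<open>real \<times> real\<close> is the Euclidean one.\<close>

definition site_norm :: "site \<Rightarrow> real" where
  "site_norm x = norm (embed x)"

definition at_infinity_site :: "site filter" where
  "at_infinity_site = filtercomap site_norm at_top"

definition origin :: site where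
  "origin = (0, 0)"

definition neighbor :: "site \<Rightarrow> site \<Rightarrow> bool" where
  "neighbor x y \<longleftrightarrow> dist (embed x) (embed y) = 1"

text \<open>Adjacency in the close-packed lattice: the diagonals of the unit faces are added
  to the nearest-neighbour edges, so that every site has eight neighbours.\<close>

definition cp_neighbor :: "site \<Rightarrow> site \<Rightarrow> bool" where
  "cp_neighbor x y \<longleftrightarrow> x \<noteq> y \<and> \<bar>fst x - fst y\<bar> \<le> 1 \<and> \<bar>snd x - snd y\<bar> \<le> 1"


section \<open>Bootstrap dynamics\<close>

definition bootstrap_step :: "config \<Rightarrow> config" where
  "bootstrap_step \<omega> = (\<lambda>x. \<omega> x \<or> card {y. neighbor x y \<and> \<omega> y} \<ge> 3)"

definition bootstrapped :: "config \<Rightarrow> config" where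
  "bootstrapped \<omega> = (\<lambda>x. lim (\<lambda>n. (bootstrap_step ^^ n) \<omega> x))"

lemma bootstrap_LIMSEQ:
  "(\<lambda>n. (bootstrap_step ^^ n) \<omega> x) \<longlonglongrightarrow> (\<exists>n. (bootstrap_step ^^ n) \<omega> x)"
proof (cases "\<exists>n. (bootstrap_step ^^ n) \<omega> x")
  case True
  then obtain n where n: "(bootstrap_step ^^ n) \<omega> x" by blast
  have "(bootstrap_step ^^ m) \<omega> x" if "m \<ge> n" for m
    using that
  proof (induction rule: dec_induct)
    case (step k)
    then show ?case by (simp add: bootstrap_step_def[of "(bootstrap_step ^^ k) \<omega>"])
  qed (rule n)
  then have "\<forall>\<^sub>F m in sequentially. (bootstrap_step ^^ m) \<omega> x = True"
    by (auto simp: eventually_sequentially)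
  then have "(\<lambda>n. (bootstrap_step ^^ n) \<omega> x) \<longlonglongrightarrow> True"
    by (rule tendsto_eventually)
  then show ?thesis using True by simp
next
  case False
  then show ?thesis by simp
qed

lemma bootstrapped_iff: "bootstrapped \<omega> x \<longleftrightarrow> (\<exists>n. (bootstrap_step ^^ n) \<omega> x)"
  unfolding bootstrapped_def using limI[OF bootstrap_LIMSEQ] by auto


section \<open>Laws of the initial and of the bootstrapped configuration\<close>

definition initial_law :: "real \<Rightarrow> config measure" where
  "initial_law p = (\<Pi>\<^sub>M x\<in>UNIV. measure_pmf (bernoulli_pmf p))"

definition bootstrapped_law :: "real \<Rightarrow> config measure" where
  "bootstrapped_law p = distr (initial_law p) (\<Pi>\<^sub>M x\<in>UNIV. count_space UNIV) bootstrapped"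

lemma finite_neighbors: "finite {y. neighbor x y}"
proof (rule finite_subset)
  show "{y. neighbor x y} \<subseteq> {fst x - 1..fst x + 1} \<times> {snd x - 1..snd x + 1}"
  proof clarsimp
    fix a b assume "neighbor x (a, b)"
    then have "(real_of_int (fst x - a))\<^sup>2 + (real_of_int (snd x - b))\<^sup>2 = 1"
      by (simp add: neighbor_def embed_def dist_prod_def dist_real_def)
    then have "\<bar>real_of_int (fst x - a)\<bar> \<le> 1" "\<bar>real_of_int (snd x - b)\<bar> \<le> 1"
      by (auto simp: abs_square_le_1[symmetric] simp del: of_int_diff)
         (smt (verit) zero_le_power2)+
    then show "fst x - 1 \<le> a \<and> a \<le> fst x + 1 \<and> snd x - 1 \<le> b \<and> b \<le> snd x + 1"
      by linarith
  qed
qed simp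

text \<open>The map \<^const>\<open>bootstrapped\<close> is measurable, so that \<^const>\<open>bootstrapped_law\<close> is indeed
  its law under the product measure.\<close>

lemma measurable_bootstrapped:
  "bootstrapped \<in> initial_law p \<rightarrow>\<^sub>M (\<Pi>\<^sub>M x\<in>UNIV. count_space UNIV)"
proof -
  let ?C = "\<Pi>\<^sub>M x\<in>(UNIV :: site set). count_space (UNIV :: bool set)"
  have sets: "sets (initial_law p) = sets ?C"
    unfolding initial_law_def by (rule sets_PiM_cong) auto
  have [measurable]: "Measurable.pred ?C (\<lambda>\<omega>. \<omega> x)" for x
    by (rule measurable_component_singleton) simp
  have "Measurable.pred ?C (\<lambda>\<omega>. bootstrap_step \<omega> x)" for x
  proof -
    have eq: "{y. neighbor x y \<and> \<omega> y} = {y \<in> {y. neighbor x y}. \<omega> y}" for \<omega> :: config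
      by auto
    have "(\<lambda>\<omega>. bootstrap_step \<omega> x)
        = (\<lambda>\<omega>. \<omega> x \<or> 3 \<le> (\<Sum>y | neighbor x y. if \<omega> y then 1 else 0 :: nat))"
      unfolding bootstrap_step_def eq
      by (simp only: card_eq_sum sum.inter_filter[OF finite_neighbors])
    then show ?thesis by simp
  qed
  then have step: "bootstrap_step \<in> ?C \<rightarrow>\<^sub>M ?C"
    by (intro measurable_PiM_single') (auto simp: space_PiM)
  have "bootstrap_step ^^ n \<in> ?C \<rightarrow>\<^sub>M ?C" for n
    by (induction n) (auto simp: comp_def id_def intro: measurable_compose[OF _ step])
  from measurable_comp[OF this measurable_component_singleton]
  have [measurable]: "Measurable.pred ?C (\<lambda>\<omega>. (bootstrap_step ^^ n) \<omega> x)" for n x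
    by (simp add: comp_def)
  have "bootstrapped \<in> ?C \<rightarrow>\<^sub>M ?C"
    by (intro measurable_PiM_single') (auto simp: space_PiM bootstrapped_iff)
  then show ?thesis
    by (simp cong: measurable_cong_sets add: sets)
qed


section \<open>Percolation quantities of a random configuration\<close>

text \<open>A closed site has the empty cluster.\<close>

definition cluster :: "config \<Rightarrow> site \<Rightarrow> site set" where
  "cluster \<omega> x = {y. \<omega> x \<and> (\<lambda>u v. \<omega> u \<and> \<omega> v \<and> cp_neighbor u v)\<^sup>*\<^sup>* x y}"

definition perc_prob :: "config measure \<Rightarrow> real" where
  "perc_prob M = \<P>(\<omega> in M. infinite (cluster \<omega> origin))"

definition connectivity :: "config measure \<Rightarrow> site \<Rightarrow> real" where
  "connectivity M x = \<P>(\<omega> in M. x \<in> cluster \<omega> origin)"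

definition decay_rate_tendsto :: "config measure \<Rightarrow> real \<Rightarrow> bool" where
  "decay_rate_tendsto M l \<longleftrightarrow>
     ((\<lambda>x. - (1 / site_norm x) * ln (connectivity M x)) \<longlongrightarrow> l) at_infinity_site"

lemma at_infinity_site_neq_bot: "at_infinity_site \<noteq> bot"
  unfolding at_infinity_site_def
proof (rule filtercomap_neq_bot)
  fix P :: "real \<Rightarrow> bool" assume "eventually P at_top"
  then obtain N where N: "\<And>r. r \<ge> N \<Longrightarrow> P r"
    by (auto simp: eventually_at_top_linorder)
  have "site_norm (\<lceil>\<bar>N\<bar>\<rceil>, 0) \<ge> N"
    by (simp add: site_norm_def embed_def norm_Pair) linarith
  then show "\<exists>x. P (site_norm x)" using N by blast
qed

lemma decay_rate_unique:
  "decay_rate_tendsto M l \<Longrightarrow> decay_rate_tendsto M l' \<Longrightarrow> l = l'"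
  unfolding decay_rate_tendsto_def
  by (rule tendsto_unique[OF at_infinity_site_neq_bot])

text \<open>Meaningful only if the limit exists, that is, if \<^term>\<open>\<exists>l. decay_rate_tendsto M l\<close>.\<close>

definition corr_length :: "config measure \<Rightarrow> real" where
  "corr_length M = inverse (THE l. decay_rate_tendsto M l)"

text \<open>\<^term>\<open>emeasure (count_space UNIV)\<close> is used as the cardinality with values in
  \<^typ>\<open>ennreal\<close>, so that infinite clusters count as infinity.\<close>

definition mean_cluster_size :: "config measure \<Rightarrow> ennreal" where
  "mean_cluster_size M = (\<integral>\<^sup>+ \<omega>. emeasure (count_space UNIV) (cluster \<omega> origin) \<partial>M)"

definition pc_star :: real where
  "pc_star = Inf {p \<in> {0..1}. perc_prob (initial_law p) > 0}"

end

theory Submission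
  imports Defs
begin

text \<open>Bootstrapping changes \<open>\<theta>\<close>, \<open>\<tau>\<close> and \<open>\<chi>\<close> only by bounded factors near the critical point and
does not change \<open>\<xi>\<close> at all, so no exponent can move.

The reason is geometric. A closed site that becomes open has at least three open neighbours
among the four. In the close-packed lattice these three already lie in one cluster, and every
one of the eight sites around the new site is equal or adjacent to one of them. A new site
therefore sticks to a single existing cluster and never joins two: sites that are open
initially are connected after bootstrapping only if they were connected before
(\<open>bootstrap_preserves_links\<close>). A finite cluster also stays inside any box around it, because
among three of the four neighbours of a site one has the same first coordinate and another
one the same second coordinate (\<open>finite_cluster_bootstrapped\<close>).

What remains is that the origin, or the endpoint \<open>x\<close> of a connection, may be open only after
bootstrapping. Opening these sites in the initial configuration can only enlarge the
bootstrapped one, so the geometric facts apply to the modified configuration; and since the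
modified event is independent of the states of the sites that were opened, it costs a factor
\<open>p\<close> per site (\<open>prob_open_site_le\<close>). This yields
\<open>\<theta>(p) \<le> \<theta>(p,\<infinity>) \<le> \<theta>(p) / p\<close> and \<open>\<tau>\<^sub>p(x) \<le> \<tau>\<^bsub>p,\<infinity>\<^esub>(x) \<le> \<tau>\<^sub>p(x) / p\<^sup>2\<close>, and summing over \<open>x\<close>
gives \<open>\<chi>(p) \<le> \<chi>(p,\<infinity>) \<le> \<chi>(p) / p\<^sup>2\<close>.

Dividing logarithms by a quantity that tends to infinity removes constant factors
(\<open>ln_ratio_limit\<close>). The factors \<open>p\<close> and \<open>p\<^sup>2\<close> are bounded below near \<open>p\<^sub>c\<^sup>*\<close> because
\<open>p\<^sub>c\<^sup>* > 0\<close>, which follows from counting self-avoiding walks (\<open>pc_star_pos\<close>). For fixed \<open>p > 0\<close>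
the same argument, applied to \<open>x\<close> tending to infinity, shows that the two connectivity
functions decay at the same exponential rate.\<close>

section \<open>Bootstrapping does not merge clusters\<close>

abbreviation linked :: "config \<Rightarrow> site \<Rightarrow> site \<Rightarrow> bool" where
  "linked \<omega> \<equiv> (\<lambda>u v. \<omega> u \<and> \<omega> v \<and> cp_neighbor u v)\<^sup>*\<^sup>*"

lemma neighbor_iff:
  "neighbor (i, j) y \<longleftrightarrow> y \<in> {(i + 1, j), (i - 1, j), (i, j + 1), (i, j - 1)}"
proof (cases y)
  case (Pair k l)
  have "neighbor (i, j) y \<longleftrightarrow> (real_of_int (i - k))\<^sup>2 + (real_of_int (j - l))\<^sup>2 = 1"
    by (simp add: Pair neighbor_def embed_def dist_prod_def dist_real_def)
  also have "\<dots> \<longleftrightarrow> (i - k)\<^sup>2 + (j - l)\<^sup>2 = 1"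
    by (metis (mono_tags, lifting) of_int_add of_int_eq_1_iff of_int_power)
  also have "\<dots> \<longleftrightarrow> \<bar>i - k\<bar> = 1 \<and> j = l \<or> i = k \<and> \<bar>j - l\<bar> = 1"
  proof
    assume *: "(i - k)\<^sup>2 + (j - l)\<^sup>2 = 1"
    then have "\<bar>i - k\<bar> \<le> 1" "\<bar>j - l\<bar> \<le> 1"
      by (auto simp: abs_square_le_1[symmetric]) (smt (verit) zero_le_power2)+
    then have "i - k \<in> {-1, 0, 1}" "j - l \<in> {-1, 0, 1}" by auto
    then show "\<bar>i - k\<bar> = 1 \<and> j = l \<or> i = k \<and> \<bar>j - l\<bar> = 1" using * by auto
  next
    assume "\<bar>i - k\<bar> = 1 \<and> j = l \<or> i = k \<and> \<bar>j - l\<bar> = 1"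
    then show "(i - k)\<^sup>2 + (j - l)\<^sup>2 = 1" by (auto simp: power2_eq_1_iff)
  qed
  finally show ?thesis by (auto simp: Pair)
qed

lemma cp_neighbor_sym: "cp_neighbor x y \<Longrightarrow> cp_neighbor y x"
  by (auto simp: cp_neighbor_def)

lemma linked_sym: "linked \<omega> x y \<Longrightarrow> linked \<omega> y x"
  by (rule sympD[OF symp_rtranclp]) (auto simp: symp_def cp_neighbor_sym)

lemma linked_mono: "\<omega> \<le> \<omega>' \<Longrightarrow> linked \<omega> x y \<Longrightarrow> linked \<omega>' x y"
  by (erule rtranclp_mono[THEN predicate2D, rotated]) (auto simp: le_fun_def)

lemma new_site_at_most_one_closed_neighbor:
  assumes "bootstrap_step \<omega> u" "\<not> \<omega> u" "neighbor u y" "neighbor u z" "y \<noteq> z"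
  shows "\<omega> y \<or> \<omega> z"
proof (rule ccontr)
  assume closed: "\<not> (\<omega> y \<or> \<omega> z)"
  obtain i j where u: "u = (i, j)" by (cases u)
  let ?N = "{(i + 1, j), (i - 1, j), (i, j + 1), (i, j - 1)}"
  have "3 \<le> card {v. neighbor u v \<and> \<omega> v}"
    using assms by (simp add: bootstrap_step_def)
  also have "\<dots> \<le> card (?N - {y, z})"
    using closed by (intro card_mono) (auto simp: u neighbor_iff)
  also have "\<dots> = card ?N - card {y, z}"
    using assms by (intro card_Diff_subset) (auto simp: u neighbor_iff)
  also have "\<dots> = 2" using assms by simp
  finally show False by simp
qed

text \<open>Arguments about a new site use only that at most one of its neighbours is closed; this is
spelled out in coordinates.\<close>

lemma new_site_cases:
  assumes "bootstrap_step \<omega> (i, j)" "\<not> \<omega> (i, j)"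
  shows "\<omega> (i + 1, j) \<or> \<omega> (i - 1, j)" "\<omega> (i + 1, j) \<or> \<omega> (i, j + 1)" "\<omega> (i + 1, j) \<or> \<omega> (i, j - 1)"
    "\<omega> (i - 1, j) \<or> \<omega> (i, j + 1)" "\<omega> (i - 1, j) \<or> \<omega> (i, j - 1)" "\<omega> (i, j + 1) \<or> \<omega> (i, j - 1)"
  by (rule new_site_at_most_one_closed_neighbor[OF assms]; simp add: neighbor_iff)+

text \<open>An open neighbour of a new site can stand in for it towards any of the eight surrounding
sites \<open>v\<close>. A diagonal \<open>v\<close> is adjacent to two of the four neighbours, a non-diagonal \<open>v\<close> to the
two neighbours perpendicular to it; in both cases at least one of the two is open.\<close>

lemma new_site_common_neighbor:
  assumes "bootstrap_step \<omega> u" "\<not> \<omega> u" "cp_neighbor u v"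
  shows "\<exists>w. neighbor u w \<and> \<omega> w \<and> (w = v \<or> cp_neighbor w v)"
proof -
  obtain i j k l where uv: "u = (i, j)" "v = (k, l)" by (metis surj_pair)
  note open_pairs = new_site_cases[of \<omega> i j, folded uv(1), OF assms(1,2)]
  have "k = i \<or> k = i + 1 \<or> k = i - 1" "l = j \<or> l = j + 1 \<or> l = j - 1" "k \<noteq> i \<or> l \<noteq> j"
    using assms(3) by (auto simp: uv cp_neighbor_def)
  then consider "k \<noteq> i" "l = j" "\<omega> (i, j + 1) \<or> \<omega> (i, j - 1)"
    | "k = i" "l \<noteq> j" "\<omega> (i + 1, j) \<or> \<omega> (i - 1, j)"
    | "k \<noteq> i" "l \<noteq> j" "\<omega> (k, j) \<or> \<omega> (i, l)"
    using open_pairs by blast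
  then obtain w where "w \<in> {(i + 1, j), (i - 1, j), (i, j + 1), (i, j - 1)}" "\<omega> w"
    and "\<bar>fst w - k\<bar> \<le> 1" "\<bar>snd w - l\<bar> \<le> 1"
  proof cases
    case 1
    then obtain t where "t = j + 1 \<or> t = j - 1" "\<omega> (i, t)" by blast
    then show ?thesis using that[of "(i, t)"] 1 \<open>k = i \<or> _\<close> by auto
  next
    case 2
    then obtain s where "s = i + 1 \<or> s = i - 1" "\<omega> (s, j)" by blast
    then show ?thesis using that[of "(s, j)"] 2 \<open>l = j \<or> _\<close> by auto
  next
    case 3
    then show ?thesis
      using that[of "(k, j)"] that[of "(i, l)"] \<open>k = i \<or> _\<close> \<open>l = j \<or> _\<close> by auto
  qed
  then have "neighbor u w \<and> \<omega> w \<and> (w = v \<or> cp_neighbor w v)"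
    by (simp add: uv neighbor_iff cp_neighbor_def)
  then show ?thesis ..
qed

text \<open>Two of the four neighbours are adjacent to each other unless they are opposite, and
opposite ones are bridged by an open neighbour from the perpendicular pair.\<close>

lemma new_site_neighbors_linked:
  assumes u: "bootstrap_step \<omega> u" "\<not> \<omega> u"
    and w: "neighbor u w" "\<omega> w" and w': "neighbor u w'" "\<omega> w'"
  shows "linked \<omega> w w'"
proof (cases "w = w' \<or> cp_neighbor w w'")
  case True
  then show ?thesis using w w' by auto
next
  case False
  obtain i j where ij: "u = (i, j)" by (cases u)
  have "\<exists>v. \<omega> v \<and> cp_neighbor w v \<and> cp_neighbor v w'"
  proof -
    consider "{w, w'} = {(i + 1, j), (i - 1, j)}" | "{w, w'} = {(i, j + 1), (i, j - 1)}"
      using False w w' unfolding ij neighbor_iff by (auto simp: cp_neighbor_def)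
    then show ?thesis
    proof cases
      case 1
      have "\<omega> (i, j + 1) \<or> \<omega> (i, j - 1)" using new_site_cases u ij by blast
      then obtain t where "t = j + 1 \<or> t = j - 1" "\<omega> (i, t)" by auto
      then show ?thesis
        using 1 by (intro exI[of _ "(i, t)"]) (auto simp: doubleton_eq_iff cp_neighbor_def)
    next
      case 2
      have "\<omega> (i + 1, j) \<or> \<omega> (i - 1, j)" using new_site_cases u ij by blast
      then obtain s where "s = i + 1 \<or> s = i - 1" "\<omega> (s, j)" by auto
      then show ?thesis
        using 2 by (intro exI[of _ "(s, j)"]) (auto simp: doubleton_eq_iff cp_neighbor_def)
    qed
  qed
  then obtain v where "\<omega> v" "cp_neighbor w v" "cp_neighbor v w'" by blast
  with w w' show ?thesis
    by (intro converse_rtranclp_into_rtranclp[OF _ r_into_rtranclp]) auto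
qed

text \<open>Every open site next to a new site can be reached through the neighbours that opened
the latter, and these are linked among themselves. At a site that is already open the links pass
through the site itself.\<close>

lemma around_open_site_linked:
  assumes u: "bootstrap_step \<omega> u"
    and a: "\<omega> a" "a = u \<or> cp_neighbor a u" and b: "\<omega> b" "b = u \<or> cp_neighbor b u"
  shows "linked \<omega> a b"
proof (cases "\<omega> u")
  case True
  then have "linked \<omega> a u" "linked \<omega> u b"
    using a b by (auto dest: cp_neighbor_sym)
  then show ?thesis by simp
next
  case False
  have near: "\<exists>w. neighbor u w \<and> \<omega> w \<and> linked \<omega> w c" if c: "\<omega> c" "c = u \<or> cp_neighbor c u" for c
  proof -
    have "cp_neighbor u c" using c False by (auto dest: cp_neighbor_sym)
    from new_site_common_neighbor[OF u False this] show ?thesis using c by blast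
  qed
  obtain w where w: "neighbor u w" "\<omega> w" "linked \<omega> w a" using near[OF a] by blast
  obtain w' where w': "neighbor u w'" "\<omega> w'" "linked \<omega> w' b" using near[OF b] by blast
  have "linked \<omega> w w'" using new_site_neighbors_linked[OF u False] w w' by blast
  then show ?thesis using linked_sym[OF w(3)] w'(3) by simp
qed

text \<open>A path through sites of the next configuration is shadowed by links in the present one.
The induction hypothesis cannot be about the current end point \<open>y\<close>, which may be new; it says
that \<open>x\<close> is linked to every presently open site at or next to \<open>y\<close>. Some presently open site is at
or next to both of two consecutive path sites, and around the second of them all presently open
sites are linked.\<close>

lemma step_preserves_links:
  assumes "linked (bootstrap_step \<omega>) x y" "\<omega> x" "\<omega> y"
  shows "linked \<omega> x y"
proof -
  have "bootstrap_step \<omega> x" using assms by (simp add: bootstrap_step_def)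
  have "\<forall>a. \<omega> a \<and> (a = y \<or> cp_neighbor a y) \<longrightarrow> linked \<omega> x a"
    using assms(1)
  proof (induction rule: rtranclp_induct)
    case base
    then show ?case using \<open>\<omega> x\<close> by (auto dest: cp_neighbor_sym)
  next
    case (step y z)
    then have yz: "bootstrap_step \<omega> y" "bootstrap_step \<omega> z" "cp_neighbor y z" by auto
    obtain w where w: "\<omega> w" "w = y \<or> cp_neighbor w y" "w = z \<or> cp_neighbor w z"
    proof (cases "\<omega> y")
      case True
      then show ?thesis using that yz by blast
    next
      case False
      obtain w where "neighbor y w" "\<omega> w" "w = z \<or> cp_neighbor w z"
        using new_site_common_neighbor[OF yz(1) False yz(3)] by blast
      moreover have "cp_neighbor w y" using \<open>neighbor y w\<close>
        by (cases y) (auto simp: neighbor_iff cp_neighbor_def)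
      ultimately show ?thesis using that by blast
    qed
    then have "linked \<omega> x w" using step.IH by blast
    moreover have "linked \<omega> w a" if "\<omega> a" "a = z \<or> cp_neighbor a z" for a
      using around_open_site_linked[OF yz(2)] w that by blast
    ultimately show ?case using rtranclp_trans[of _ x w] by simp
  qed
  then show ?thesis using assms by blast
qed

lemma bootstrap_power_mono:
  "m \<le> n \<Longrightarrow> (bootstrap_step ^^ m) \<omega> x \<Longrightarrow> (bootstrap_step ^^ n) \<omega> x"
  by (induction rule: dec_induct) (auto simp: bootstrap_step_def[of "(bootstrap_step ^^ _) _"])

lemma bootstrapped_ge: "\<omega> \<le> bootstrapped \<omega>"
proof (rule le_funI, rule le_boolI)
  fix x assume "\<omega> x"
  then have "(bootstrap_step ^^ 0) \<omega> x" by simp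
  then show "bootstrapped \<omega> x" unfolding bootstrapped_iff by blast
qed

lemma bootstrapped_mono:
  assumes "\<omega> \<le> \<omega>'" shows "bootstrapped \<omega> \<le> bootstrapped \<omega>'"
proof -
  have step: "bootstrap_step \<omega> \<le> bootstrap_step \<omega>'" if "\<omega> \<le> \<omega>'" for \<omega> \<omega>'
  proof (rule le_funI, rule le_boolI)
    fix x assume "bootstrap_step \<omega> x"
    moreover have "card {y. neighbor x y \<and> \<omega> y} \<le> card {y. neighbor x y \<and> \<omega>' y}"
      using that by (intro card_mono finite_subset[OF _ finite_neighbors[of x]]) (auto simp: le_fun_def)
    ultimately show "bootstrap_step \<omega>' x"
      using le_funD[OF that, of x] by (auto simp: bootstrap_step_def)
  qed
  have "(bootstrap_step ^^ n) \<omega> \<le> (bootstrap_step ^^ n) \<omega>'" for n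
    by (induction n) (simp_all add: assms step)
  then show ?thesis by (auto simp: le_fun_def bootstrapped_iff)
qed

text \<open>A finite path in the final configuration is already present at some finite time, from
which the links are pulled back one step at a time.\<close>

theorem bootstrap_preserves_links:
  assumes "linked (bootstrapped \<omega>) x y" "\<omega> x" "\<omega> y"
  shows "linked \<omega> x y"
proof -
  have "\<exists>n. linked ((bootstrap_step ^^ n) \<omega>) x y"
    using assms(1)
  proof (induction rule: rtranclp_induct)
    case (step y z)
    then obtain k l m where k: "linked ((bootstrap_step ^^ k) \<omega>) x y"
      and lm: "(bootstrap_step ^^ l) \<omega> y" "(bootstrap_step ^^ m) \<omega> z"
      by (auto simp: bootstrapped_iff)
    define n where "n = max k (max l m)"
    have "linked ((bootstrap_step ^^ n) \<omega>) x y"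
      by (rule linked_mono[OF _ k]) (auto simp: n_def le_fun_def intro: bootstrap_power_mono[rotated])
    moreover have "(bootstrap_step ^^ n) \<omega> y" "(bootstrap_step ^^ n) \<omega> z"
      using lm by (auto simp: n_def intro: bootstrap_power_mono[rotated])
    ultimately have "linked ((bootstrap_step ^^ n) \<omega>) x z"
      using step.hyps by (auto intro: rtranclp.rtrancl_into_rtrancl)
    then show ?case ..
  qed auto
  then obtain n where "linked ((bootstrap_step ^^ n) \<omega>) x y" ..
  then show ?thesis
  proof (induction n)
    case (Suc n)
    have "(bootstrap_step ^^ n) \<omega> x" "(bootstrap_step ^^ n) \<omega> y"
      using assms bootstrap_power_mono[of 0 n] by simp_all
    with Suc step_preserves_links show ?case by simp
  qed simp
qed

lemma cluster_open:
  assumes "y \<in> cluster \<omega> x"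
  shows "\<omega> y"
proof -
  have "linked \<omega> x y" "\<omega> x" using assms by (simp_all add: cluster_def)
  then show ?thesis by (induction rule: rtranclp_induct) simp_all
qed

text \<open>Finiteness as a countable condition, which is convenient both for measurability and for
the bounding box argument.\<close>

lemma finite_iff_in_box: "finite S \<longleftrightarrow> (\<exists>n::nat. \<forall>y\<in>S. \<bar>fst y\<bar> \<le> int n \<and> \<bar>snd y\<bar> \<le> int n)"
  for S :: "site set"
proof
  assume S: "finite S"
  have "\<bar>fst y\<bar> \<le> int (nat (\<Sum>y\<in>S. \<bar>fst y\<bar> + \<bar>snd y\<bar>)) \<and>
      \<bar>snd y\<bar> \<le> int (nat (\<Sum>y\<in>S. \<bar>fst y\<bar> + \<bar>snd y\<bar>))" if "y \<in> S" for y
    using member_le_sum[of y S "\<lambda>y. \<bar>fst y\<bar> + \<bar>snd y\<bar>"] S that by auto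
  then show "\<exists>n::nat. \<forall>y\<in>S. \<bar>fst y\<bar> \<le> int n \<and> \<bar>snd y\<bar> \<le> int n" by blast
next
  assume "\<exists>n::nat. \<forall>y\<in>S. \<bar>fst y\<bar> \<le> int n \<and> \<bar>snd y\<bar> \<le> int n"
  then obtain n :: nat where "\<forall>y\<in>S. \<bar>fst y\<bar> \<le> int n \<and> \<bar>snd y\<bar> \<le> int n" by blast
  then have "S \<subseteq> {- int n..int n} \<times> {- int n..int n}" by (auto simp: abs_le_iff)
  then show "finite S" by (rule finite_subset) simp
qed

text \<open>The sites of the final cluster are added in the order of the times at which they open.
The three open neighbours of a new site belong to the same final cluster, hence lie in the
box by induction; they include a horizontal neighbour, which has the same second coordinate,
and a vertical one, which has the same first coordinate.\<close>

lemma finite_cluster_bootstrapped: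
  assumes "finite (cluster \<omega> x)" "\<omega> x"
  shows "finite (cluster (bootstrapped \<omega>) x)"
proof -
  let ?C = "cluster (bootstrapped \<omega>) x"
  obtain B :: nat where B: "\<And>y. y \<in> cluster \<omega> x \<Longrightarrow> \<bar>fst y\<bar> \<le> int B \<and> \<bar>snd y\<bar> \<le> int B"
    using assms(1) unfolding finite_iff_in_box by blast
  have box: "\<bar>fst y\<bar> \<le> int B \<and> \<bar>snd y\<bar> \<le> int B"
    if "(bootstrap_step ^^ n) \<omega> y" "y \<in> ?C" for n y
    using that
  proof (induction n arbitrary: y)
    case 0
    then have "linked (bootstrapped \<omega>) x y" "\<omega> y" by (simp_all add: cluster_def)
    then have "linked \<omega> x y" using assms(2) bootstrap_preserves_links by blast
    then have "y \<in> cluster \<omega> x" using assms(2) by (simp add: cluster_def)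
    then show ?case by (rule B)
  next
    case (Suc n)
    let ?\<omega> = "(bootstrap_step ^^ n) \<omega>"
    show ?case
    proof (cases "?\<omega> y")
      case True
      then show ?thesis using Suc.IH Suc.prems(2) by blast
    next
      case False
      obtain i j where y: "y = (i, j)" by (cases y)
      have in_box: "\<bar>fst v\<bar> \<le> int B \<and> \<bar>snd v\<bar> \<le> int B" if v: "?\<omega> v" "neighbor y v" for v
      proof (rule Suc.IH[OF v(1)])
        have link: "linked (bootstrapped \<omega>) x y" "bootstrapped \<omega> x"
          using Suc.prems(2) by (simp_all add: cluster_def)
        have "bootstrapped \<omega> v" using v(1) unfolding bootstrapped_iff ..
        moreover have "bootstrapped \<omega> y" using Suc.prems(2) by (rule cluster_open)
        moreover have "cp_neighbor y v" using v(2) by (auto simp: y neighbor_iff cp_neighbor_def)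
        ultimately have "linked (bootstrapped \<omega>) x v"
          by (intro rtranclp.rtrancl_into_rtrancl[OF link(1)] conjI)
        then show "v \<in> ?C" using link(2) by (simp add: cluster_def)
      qed
      have step: "bootstrap_step ?\<omega> (i, j)" "\<not> ?\<omega> (i, j)" using Suc.prems(1) False y by simp_all
      have "\<bar>j\<bar> \<le> int B"
        using new_site_cases(1)[OF step] in_box[of "(i + 1, j)"] in_box[of "(i - 1, j)"]
        by (auto simp: y neighbor_iff)
      moreover have "\<bar>i\<bar> \<le> int B"
        using new_site_cases(6)[OF step] in_box[of "(i, j + 1)"] in_box[of "(i, j - 1)"]
        by (auto simp: y neighbor_iff)
      ultimately show ?thesis by (simp add: y)
    qed
  qed
  have "\<bar>fst y\<bar> \<le> int B \<and> \<bar>snd y\<bar> \<le> int B" if y: "y \<in> ?C" for y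
  proof -
    obtain n where "(bootstrap_step ^^ n) \<omega> y"
      using cluster_open[OF y] unfolding bootstrapped_iff ..
    then show ?thesis using y by (rule box)
  qed
  then have "\<exists>n::nat. \<forall>y\<in>?C. \<bar>fst y\<bar> \<le> int n \<and> \<bar>snd y\<bar> \<le> int n" by blast
  then show ?thesis by (simp only: finite_iff_in_box)
qed

lemma cluster_mono:
  assumes "\<omega> \<le> \<omega>'"
  shows "cluster \<omega> x \<subseteq> cluster \<omega>' x"
proof
  fix y assume "y \<in> cluster \<omega> x"
  then have "linked \<omega> x y" "\<omega> x" by (simp_all add: cluster_def)
  moreover have "\<omega>' x" using \<open>\<omega> x\<close> le_funD[OF assms, of x] by simp
  ultimately show "y \<in> cluster \<omega>' x"
    using linked_mono[OF assms] by (simp add: cluster_def)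
qed

abbreviation open_site :: "site \<Rightarrow> config \<Rightarrow> config" where
  "open_site x \<omega> \<equiv> fun_upd \<omega> x True"

text \<open>Opening the site \<open>x\<close> in advance covers the case that \<open>x\<close> is opened by the dynamics; the
final cluster can only grow by this change.\<close>

lemma infinite_cluster_bootstrapped_imp:
  assumes "infinite (cluster (bootstrapped \<omega>) x)"
  shows "infinite (cluster (open_site x \<omega>) x)"
proof
  assume "finite (cluster (open_site x \<omega>) x)"
  then have "finite (cluster (bootstrapped (open_site x \<omega>)) x)"
    by (rule finite_cluster_bootstrapped) simp
  moreover have "bootstrapped \<omega> \<le> bootstrapped (open_site x \<omega>)"
    by (intro bootstrapped_mono) (auto simp: le_fun_def)
  ultimately show False
    using assms finite_subset[OF cluster_mono] by metis
qed

lemma connected_bootstrapped_imp: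
  assumes "y \<in> cluster (bootstrapped \<omega>) x"
  shows "y \<in> cluster (open_site y (open_site x \<omega>)) x"
proof -
  let ?\<omega> = "open_site y (open_site x \<omega>)"
  have "bootstrapped \<omega> \<le> bootstrapped ?\<omega>"
    by (intro bootstrapped_mono) (auto simp: le_fun_def)
  then have "y \<in> cluster (bootstrapped ?\<omega>) x" using assms cluster_mono by blast
  then have "linked (bootstrapped ?\<omega>) x y" by (simp add: cluster_def)
  then have "linked ?\<omega> x y" by (rule bootstrap_preserves_links) simp_all
  then show ?thesis by (simp add: cluster_def)
qed

section \<open>Closing the gap at the end points by resampling\<close>

abbreviation open_prob :: "real \<Rightarrow> real" where
  "open_prob p \<equiv> pmf (bernoulli_pmf p) True"

abbreviation config_space :: "config measure" where
  "config_space \<equiv> \<Pi>\<^sub>M x\<in>UNIV. count_space UNIV"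

lemma sets_initial_law [measurable_cong]: "sets (initial_law p) = sets config_space"
  unfolding initial_law_def by (rule sets_PiM_cong) auto

lemma space_initial_law [simp]: "space (initial_law p) = UNIV"
  by (simp add: initial_law_def space_PiM PiE_UNIV_domain)

lemma space_config_space [simp]: "space config_space = UNIV"
  by (simp add: space_PiM PiE_UNIV_domain)

lemma sets_bootstrapped_law [measurable_cong]: "sets (bootstrapped_law p) = sets config_space"
  by (simp add: bootstrapped_law_def)

lemma prob_space_initial_law: "prob_space (initial_law p)"
  unfolding initial_law_def by (intro prob_space_PiM prob_space_measure_pmf)

lemma prob_space_bootstrapped_law: "prob_space (bootstrapped_law p)"
  unfolding bootstrapped_law_def
  by (rule prob_space.prob_space_distr[OF prob_space_initial_law measurable_bootstrapped])

lemma pred_site [measurable]: "Measurable.pred config_space (\<lambda>\<omega>. \<omega> x)"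
  by (rule measurable_component_singleton) simp

text \<open>Connection is a countable union, over path lengths, of events that depend on
the states of the sites through countable operations.\<close>

lemma pred_linked [measurable]: "Measurable.pred config_space (\<lambda>\<omega>. linked \<omega> x y)"
proof -
  let ?R = "\<lambda>\<omega> u v. \<omega> u \<and> \<omega> v \<and> cp_neighbor u v"
  have "Measurable.pred config_space (\<lambda>\<omega>. (?R \<omega> ^^ n) x y)" for n
    by (induction n arbitrary: y) (simp_all add: relcompp.simps)
  then have "Measurable.pred config_space (\<lambda>\<omega>. \<exists>n. (?R \<omega> ^^ n) x y)"
    by measurable
  then show ?thesis by (simp add: rtranclp_power)
qed

lemma pred_cluster [measurable]: "Measurable.pred config_space (\<lambda>\<omega>. y \<in> cluster \<omega> x)"
  by (simp add: cluster_def)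

lemma pred_infinite_cluster [measurable]:
  "Measurable.pred config_space (\<lambda>\<omega>. infinite (cluster \<omega> x))"
  unfolding finite_iff_in_box Ball_def by measurable

lemma prob_bootstrapped_law:
  assumes "Measurable.pred config_space Q"
  shows "\<P>(\<omega> in bootstrapped_law p. Q \<omega>) = \<P>(\<omega> in initial_law p. Q (bootstrapped \<omega>))"
  using measure_distr[OF measurable_bootstrapped, of "{\<omega>. Q \<omega>}" p] assms
  by (simp add: bootstrapped_law_def vimage_def pred_def)

lemma pred_bootstrapped:
  "Measurable.pred config_space Q \<Longrightarrow> Measurable.pred config_space (\<lambda>\<omega>. Q (bootstrapped \<omega>))"
  using measurable_compose[OF measurable_bootstrapped, of Q "count_space UNIV" 0]
  by (simp cong: measurable_cong_sets add: sets_initial_law)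

lemma measurable_open_site: "open_site x \<in> config_space \<rightarrow>\<^sub>M config_space"
  by (intro measurable_PiM_single') (auto simp: space_PiM fun_upd_def)

text \<open>Replacing the state at \<open>x\<close> by an independent Bernoulli variable does not change the law.
With probability \<^term>\<open>open_prob p\<close> the new state is open, and then the resampled configuration is
\<^term>\<open>open_site x \<omega>\<close>.\<close>

lemma prob_open_site_le:
  assumes [measurable]: "Measurable.pred config_space Q"
  shows "open_prob p * \<P>(\<omega> in initial_law p. Q (open_site x \<omega>))
    \<le> \<P>(\<omega> in initial_law p. Q \<omega>)"
proof -
  let ?L = "initial_law p" and ?B = "measure_pmf (bernoulli_pmf p)"
  interpret L: prob_space ?L by (rule prob_space_initial_law)
  interpret BL: pair_prob_space ?B ?L ..
  note [measurable] = measurable_open_site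
  have resample: "?L = distr (?B \<Otimes>\<^sub>M ?L) config_space (\<lambda>(b, \<omega>). fun_upd \<omega> x b)"
  proof -
    \<comment> \<open>With the full index set, inserting \<open>x\<close> means overwriting the state at \<open>x\<close>.\<close>
    have "?L = distr (?B \<Otimes>\<^sub>M ?L) ?L (\<lambda>(b, \<omega>). fun_upd \<omega> x b)"
      using distr_pair_PiM_eq_PiM[of UNIV "\<lambda>_. ?B" x]
      by (simp add: initial_law_def prob_space_measure_pmf)
    also have "\<dots> = distr (?B \<Otimes>\<^sub>M ?L) config_space (\<lambda>(b, \<omega>). fun_upd \<omega> x b)"
      by (rule distr_cong) (simp_all add: sets_initial_law)
    finally show ?thesis .
  qed
  have update [measurable]: "(\<lambda>(b, \<omega>). fun_upd \<omega> x b) \<in> ?B \<Otimes>\<^sub>M ?L \<rightarrow>\<^sub>M config_space"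
    by (intro measurable_PiM_single') (auto simp: space_PiM fun_upd_def case_prod_beta)
  have E: "{\<omega>. Q (open_site x \<omega>)} \<in> sets ?L"
    using predE[OF measurable_compose[OF measurable_open_site assms]]
    by (simp add: sets_initial_law)
  have Q: "{\<omega>. Q \<omega>} \<in> sets config_space" using predE[OF assms] by simp
  have "open_prob p * L.prob {\<omega>. Q (open_site x \<omega>)}
      = BL.prob ({True} \<times> {\<omega>. Q (open_site x \<omega>)})"
    using E by (simp add: measure_def L.emeasure_pair_measure_Times enn2real_mult emeasure_pmf_single)
  also have "\<dots> \<le> BL.prob ((\<lambda>(b, \<omega>). fun_upd \<omega> x b) -` {\<omega>. Q \<omega>} \<inter> space (?B \<Otimes>\<^sub>M ?L))"
    by (intro BL.finite_measure_mono measurable_sets[OF update])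
       (auto simp: space_pair_measure Q)
  also have "\<dots> = L.prob {\<omega>. Q \<omega>}"
    by (subst (2) resample, subst measure_distr[OF update]) (simp_all add: Q)
  finally show ?thesis by simp
qed

text \<open>The lower bound is monotonicity. For the upper bound the origin is opened, at a cost of one
factor \<^term>\<open>open_prob p\<close>, so that an infinite final cluster comes from an infinite initial one.\<close>

theorem perc_prob_compare:
  "perc_prob (initial_law p) \<le> perc_prob (bootstrapped_law p)"
  "open_prob p * perc_prob (bootstrapped_law p) \<le> perc_prob (initial_law p)"
proof -
  interpret L: prob_space "initial_law p" by (rule prob_space_initial_law)
  note [measurable] = pred_bootstrapped measurable_compose[OF measurable_open_site, of _ "count_space UNIV"]
  have boot: "perc_prob (bootstrapped_law p)
      = \<P>(\<omega> in initial_law p. infinite (cluster (bootstrapped \<omega>) origin))"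
    unfolding perc_prob_def by (rule prob_bootstrapped_law) measurable
  show "perc_prob (initial_law p) \<le> perc_prob (bootstrapped_law p)"
    unfolding boot unfolding perc_prob_def
  proof (rule L.finite_measure_mono)
    show "{\<omega> \<in> space (initial_law p). infinite (cluster \<omega> origin)}
        \<subseteq> {\<omega> \<in> space (initial_law p). infinite (cluster (bootstrapped \<omega>) origin)}"
      using finite_subset[OF cluster_mono[OF bootstrapped_ge], of _ origin] by auto
  qed measurable
  have "perc_prob (bootstrapped_law p)
      \<le> \<P>(\<omega> in initial_law p. infinite (cluster (open_site origin \<omega>) origin))"
    unfolding boot
  proof (rule L.finite_measure_mono)
    show "{\<omega> \<in> space (initial_law p). infinite (cluster (bootstrapped \<omega>) origin)}
        \<subseteq> {\<omega> \<in> space (initial_law p). infinite (cluster (open_site origin \<omega>) origin)}"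
      using infinite_cluster_bootstrapped_imp by blast
  qed measurable
  then have "open_prob p * perc_prob (bootstrapped_law p) \<le> open_prob p * \<dots>"
    by (rule mult_left_mono) simp
  also have "\<dots> \<le> perc_prob (initial_law p)"
    unfolding perc_prob_def by (rule prob_open_site_le) measurable
  finally show "open_prob p * perc_prob (bootstrapped_law p) \<le> perc_prob (initial_law p)" .
qed

text \<open>As for the percolation probability, except that both end points have to be opened.\<close>

theorem connectivity_compare:
  "connectivity (initial_law p) y \<le> connectivity (bootstrapped_law p) y"
  "(open_prob p)\<^sup>2 * connectivity (bootstrapped_law p) y \<le> connectivity (initial_law p) y"
proof -
  interpret L: prob_space "initial_law p" by (rule prob_space_initial_law)
  let ?q = "open_prob p"
  note [measurable] = pred_bootstrapped measurable_compose[OF measurable_open_site, of _ "count_space UNIV"]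
  have boot: "connectivity (bootstrapped_law p) y
      = \<P>(\<omega> in initial_law p. y \<in> cluster (bootstrapped \<omega>) origin)"
    unfolding connectivity_def by (rule prob_bootstrapped_law) measurable
  show "connectivity (initial_law p) y \<le> connectivity (bootstrapped_law p) y"
    unfolding boot unfolding connectivity_def
  proof (rule L.finite_measure_mono)
    show "{\<omega> \<in> space (initial_law p). y \<in> cluster \<omega> origin}
        \<subseteq> {\<omega> \<in> space (initial_law p). y \<in> cluster (bootstrapped \<omega>) origin}"
      using cluster_mono[OF bootstrapped_ge] by blast
  qed measurable
  have "connectivity (bootstrapped_law p) y
      \<le> \<P>(\<omega> in initial_law p. y \<in> cluster (open_site y (open_site origin \<omega>)) origin)"
    unfolding boot
  proof (rule L.finite_measure_mono)
    show "{\<omega> \<in> space (initial_law p). y \<in> cluster (bootstrapped \<omega>) origin}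
        \<subseteq> {\<omega> \<in> space (initial_law p). y \<in> cluster (open_site y (open_site origin \<omega>)) origin}"
      using connected_bootstrapped_imp by blast
  qed measurable
  then have "?q\<^sup>2 * connectivity (bootstrapped_law p) y \<le> ?q\<^sup>2 * \<dots>"
    by (rule mult_left_mono) simp
  also have "\<dots> = ?q * (?q * \<P>(\<omega> in initial_law p. y \<in> cluster (open_site y (open_site origin \<omega>)) origin))"
    by (simp add: power2_eq_square)
  also have "\<dots> \<le> ?q * \<P>(\<omega> in initial_law p. y \<in> cluster (open_site y \<omega>) origin)"
    by (intro mult_left_mono prob_open_site_le[where Q = "\<lambda>\<omega>. y \<in> cluster (open_site y \<omega>) origin"]) simp_all
  also have "\<dots> \<le> connectivity (initial_law p) y"
    unfolding connectivity_def by (rule prob_open_site_le) measurable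
  finally show "?q\<^sup>2 * connectivity (bootstrapped_law p) y \<le> connectivity (initial_law p) y" .
qed

text \<open>Tonelli's theorem, after writing the size of the cluster as a sum of indicators. In this
form the pointwise comparison of connectivity functions carries over.\<close>

lemma mean_cluster_size_eq:
  assumes "prob_space M" and [measurable_cong]: "sets M = sets config_space"
  shows "mean_cluster_size M = (\<integral>\<^sup>+ y. ennreal (connectivity M y) \<partial>count_space UNIV)"
proof -
  interpret prob_space M by fact
  have "mean_cluster_size M = (\<integral>\<^sup>+ \<omega>. (\<integral>\<^sup>+ y. indicator (cluster \<omega> origin) y \<partial>count_space UNIV) \<partial>M)"
    unfolding mean_cluster_size_def by simp
  also have "\<dots> = (\<integral>\<^sup>+ y. (\<integral>\<^sup>+ \<omega>. indicator (cluster \<omega> origin) y \<partial>M) \<partial>count_space UNIV)"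
    by (rule nn_integral_count_space_nn_integral) auto
  also have "\<dots> = (\<integral>\<^sup>+ y. ennreal (connectivity M y) \<partial>count_space UNIV)"
  proof (rule nn_integral_cong)
    fix y
    have "(\<integral>\<^sup>+ \<omega>. indicator (cluster \<omega> origin) y \<partial>M)
        = (\<integral>\<^sup>+ \<omega>. indicator {\<omega> \<in> space M. y \<in> cluster \<omega> origin} \<omega> \<partial>M)"
      by (intro nn_integral_cong) (simp add: indicator_def)
    also have "\<dots> = ennreal (connectivity M y)"
      unfolding connectivity_def by (subst nn_integral_indicator) (auto simp: emeasure_eq_measure)
    finally show "(\<integral>\<^sup>+ \<omega>. indicator (cluster \<omega> origin) y \<partial>M) = ennreal (connectivity M y)" .
  qed
  finally show ?thesis .
qed

theorem mean_cluster_size_compare: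
  "mean_cluster_size (initial_law p) \<le> mean_cluster_size (bootstrapped_law p)"
  "ennreal ((open_prob p)\<^sup>2) * mean_cluster_size (bootstrapped_law p)
    \<le> mean_cluster_size (initial_law p)"
  unfolding mean_cluster_size_eq[OF prob_space_initial_law sets_initial_law]
    mean_cluster_size_eq[OF prob_space_bootstrapped_law sets_bootstrapped_law]
  by (auto simp: nn_integral_cmult[symmetric] ennreal_mult'[symmetric] connectivity_compare
      intro!: nn_integral_mono ennreal_leI)

section \<open>Positivity of the critical value\<close>

text \<open>Walks are stored with the most recent site at the head, so that \<^const>\<open>drop\<close> shortens a
walk to one of its initial pieces.\<close>

fun walks :: "nat \<Rightarrow> site list set" where
  "walks 0 = {[origin]}"
| "walks (Suc n) = (\<Union>xs\<in>walks n. (\<lambda>y. y # xs) ` {y. cp_neighbor (hd xs) y})"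

text \<open>The enclosing block of three by three sites gives the crude constant \<open>9\<close>, which is
enough for a positive lower bound on the critical value.\<close>

lemma finite_card_cp_neighbors: "finite {y. cp_neighbor x y} \<and> card {y. cp_neighbor x y} \<le> 9"
proof -
  let ?B = "{fst x - 1..fst x + 1} \<times> {snd x - 1..snd x + 1}"
  have "{y. cp_neighbor x y} \<subseteq> ?B" by (auto simp: cp_neighbor_def)
  moreover have "card ?B = 9" by (simp add: card_cartesian_product)
  moreover have "finite ?B" by simp
  ultimately show ?thesis by (metis card_mono finite_subset)
qed

lemma finite_card_walks: "finite (walks n) \<and> card (walks n) \<le> 9 ^ n"
proof (induction n)
  case (Suc n)
  have "card (walks (Suc n)) \<le> (\<Sum>xs\<in>walks n. card ((\<lambda>y. y # xs) ` {y. cp_neighbor (hd xs) y}))"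
    using Suc by (simp add: card_UN_le)
  also have "\<dots> \<le> (\<Sum>xs\<in>walks n. 9)"
    by (intro sum_mono le_trans[OF card_image_le]) (simp_all add: finite_card_cp_neighbors)
  also have "\<dots> \<le> 9 ^ Suc n" using Suc by simp
  finally show ?case using Suc by (simp add: finite_card_cp_neighbors)
qed simp

lemma length_walks: "xs \<in> walks n \<Longrightarrow> length xs = Suc n"
  by (induction n arbitrary: xs) auto

lemma drop_walks: "xs \<in> walks (n + k) \<Longrightarrow> drop k xs \<in> walks n"
  by (induction k arbitrary: xs) auto

lemma hd_walks_bound: "xs \<in> walks n \<Longrightarrow> \<bar>fst (hd xs)\<bar> \<le> int n \<and> \<bar>snd (hd xs)\<bar> \<le> int n"
proof (induction n arbitrary: xs)
  case (Suc n)
  then obtain y ys where "xs = y # ys" "ys \<in> walks n" "cp_neighbor (hd ys) y" by auto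
  with Suc.IH[of ys] show ?case by (auto simp: cp_neighbor_def)
qed (simp add: origin_def)

text \<open>A walk is extended along a path in the cluster; when it would return to a site that it
has visited, the loop is cut off instead.\<close>

lemma cluster_self_avoiding_walk:
  assumes "y \<in> cluster \<omega> origin"
  shows "\<exists>n. \<exists>xs\<in>walks n. distinct xs \<and> (\<forall>u\<in>set xs. \<omega> u) \<and> hd xs = y"
proof -
  have "\<omega> origin" "linked \<omega> origin y"
    using assms by (auto simp: cluster_def)
  from this(2) show ?thesis
  proof (induction rule: rtranclp_induct)
    case base
    show ?case using \<open>\<omega> origin\<close> by (intro exI[of _ 0]) simp
  next
    case (step y z)
    then obtain n xs where xs: "xs \<in> walks n" "distinct xs" "\<forall>u\<in>set xs. \<omega> u" "hd xs = y" by blast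
    show ?case
    proof (cases "z \<in> set xs")
      case True
      then obtain k where k: "k < length xs" "xs ! k = z" by (auto simp: in_set_conv_nth)
      then have "drop k xs \<in> walks (n - k)"
        using drop_walks[of xs "n - k" k] xs(1) length_walks[OF xs(1)] by simp
      moreover have "hd (drop k xs) = z" using k by (simp add: hd_drop_conv_nth)
      ultimately show ?thesis
        using xs by (intro exI[of _ "n - k"] bexI[of _ "drop k xs"]) (auto dest: in_set_dropD)
    next
      case False
      then show ?thesis
        using xs step.hyps by (intro exI[of _ "Suc n"] bexI[of _ "z # xs"]) auto
    qed
  qed
qed

text \<open>An infinite cluster leaves every box, and a walk that leaves the box of radius \<open>n\<close> has more
than \<open>n\<close> steps.\<close>

lemma infinite_cluster_long_walk:
  assumes "infinite (cluster \<omega> origin)"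
  shows "\<exists>xs\<in>walks n. distinct xs \<and> (\<forall>u\<in>set xs. \<omega> u)"
proof -
  have "\<exists>y\<in>cluster \<omega> origin. \<not> (\<bar>fst y\<bar> \<le> int n \<and> \<bar>snd y\<bar> \<le> int n)"
    using assms unfolding finite_iff_in_box by blast
  then obtain y where y: "y \<in> cluster \<omega> origin" "\<not> (\<bar>fst y\<bar> \<le> int n \<and> \<bar>snd y\<bar> \<le> int n)" ..
  obtain m xs where xs: "xs \<in> walks m" "distinct xs" "\<forall>u\<in>set xs. \<omega> u" "hd xs = y"
    using cluster_self_avoiding_walk[OF y(1)] by blast
  have "n \<le> m" using hd_walks_bound[OF xs(1), unfolded xs(4)] y(2) by linarith
  then have "drop (m - n) xs \<in> walks n" using drop_walks[of xs n "m - n"] xs(1) by simp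
  then show ?thesis using xs by (intro bexI[of _ "drop (m - n) xs"]) (auto dest: in_set_dropD)
qed

lemma prob_all_open:
  assumes "finite S"
  shows "\<P>(\<omega> in initial_law p. \<forall>x\<in>S. \<omega> x) = open_prob p ^ card S"
proof -
  interpret P: product_prob_space "\<lambda>_. measure_pmf (bernoulli_pmf p)" "UNIV :: site set" ..
  have "emeasure (initial_law p) {\<omega> \<in> space (initial_law p). \<forall>x\<in>S. \<omega> x \<in> {True}}
      = (\<Prod>x\<in>S. emeasure (measure_pmf (bernoulli_pmf p)) {True})"
    unfolding initial_law_def using assms by (intro P.emeasure_PiM_Collect) auto
  also have "\<dots> = ennreal (open_prob p ^ card S)"
    by (simp add: emeasure_pmf_single ennreal_power)
  finally show ?thesis by (simp add: measure_def)
qed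

text \<open>A union bound over the at most \<open>9 ^ n\<close> self-avoiding walks of \<open>n\<close> steps, each of which visits
\<open>n + 1\<close> different sites.\<close>

lemma perc_prob_le:
  "perc_prob (initial_law p) \<le> (9 * open_prob p) ^ n"
proof -
  interpret L: prob_space "initial_law p" by (rule prob_space_initial_law)
  let ?q = "open_prob p"
  let ?W = "{xs \<in> walks n. distinct xs}"
  let ?O = "\<lambda>xs. {\<omega> \<in> space (initial_law p). \<forall>u\<in>set xs. \<omega> u}"
  have fin: "finite ?W" using finite_card_walks by simp
  have meas: "?O xs \<in> sets (initial_law p)" for xs
    by measurable
  have "perc_prob (initial_law p) \<le> L.prob (\<Union>xs\<in>?W. ?O xs)"
    unfolding perc_prob_def
    using infinite_cluster_long_walk[of _ n] fin meas
    by (intro L.finite_measure_mono sets.finite_UN) fastforce+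
  also have "\<dots> \<le> (\<Sum>xs\<in>?W. L.prob (?O xs))"
    using fin meas by (intro L.finite_measure_subadditive_finite) auto
  also have "\<dots> = (\<Sum>xs\<in>?W. ?q ^ Suc n)"
  proof (intro sum.cong refl)
    fix xs assume "xs \<in> ?W"
    then show "L.prob (?O xs) = ?q ^ Suc n"
      using prob_all_open[of "set xs" p] length_walks[of xs n] by (simp add: distinct_card)
  qed
  also have "\<dots> \<le> (\<Sum>xs\<in>?W. ?q ^ n)"
    by (intro sum_mono power_decreasing) (simp_all add: pmf_le_1)
  also have "\<dots> = real (card ?W) * ?q ^ n" by simp
  also have "\<dots> \<le> real (9 ^ n) * ?q ^ n"
  proof (intro mult_right_mono of_nat_mono)
    have "card ?W \<le> card (walks n)" using finite_card_walks by (intro card_mono) auto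
    then show "card ?W \<le> 9 ^ n" using finite_card_walks[of n] by simp
  qed simp
  also have "\<dots> = (9 * ?q) ^ n" by (simp add: power_mult_distrib)
  finally show ?thesis .
qed

text \<open>This makes the set in the definition of \<^const>\<open>pc_star\<close> nonempty, so that its infimum is
meaningful.\<close>

lemma perc_prob_one: "perc_prob (initial_law 1) = 1"
proof -
  interpret L: prob_space "initial_law 1" by (rule prob_space_initial_law)
  have "AE b in measure_pmf (bernoulli_pmf 1). b"
    unfolding AE_measure_pmf_iff
  proof
    fix b assume "b \<in> set_pmf (bernoulli_pmf 1)"
    then show b by (cases b) (simp_all add: set_pmf_iff)
  qed
  then have "AE \<omega> in initial_law 1. \<omega> x" for x
    unfolding initial_law_def
    by (intro AE_PiM_component[where P = "\<lambda>b. b"] prob_space_measure_pmf) simp_all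
  then have "AE \<omega> in initial_law 1. \<forall>x. \<omega> x" by (simp add: AE_all_countable)
  then have "AE \<omega> in initial_law 1. infinite (cluster \<omega> origin)"
  proof eventually_elim
    case (elim \<omega>)
    have "(int n, 0) \<in> cluster \<omega> origin" for n
    proof (induction n)
      case 0
      show ?case using elim by (simp add: cluster_def origin_def)
    next
      case (Suc n)
      have "\<omega> (int n, 0) \<and> \<omega> (int (Suc n), 0) \<and> cp_neighbor (int n, 0) (int (Suc n), 0)"
        using elim by (simp add: cp_neighbor_def)
      then show ?case
        using Suc elim unfolding cluster_def mem_Collect_eq
        by (blast intro: rtranclp.rtrancl_into_rtrancl)
    qed
    then have "range (\<lambda>n. (int n, 0)) \<subseteq> cluster \<omega> origin" by blast
    moreover have "infinite (range (\<lambda>n::nat. (int n, 0::int)))"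
      by (rule range_inj_infinite) (simp add: inj_def)
    ultimately show ?case by (meson finite_subset)
  qed
  then show ?thesis unfolding perc_prob_def
    by (subst L.prob_Collect_eq_1) measurable
qed

text \<open>Truncated outside the unit interval; such parameters would occur in every right neighbourhood
of the critical value if that were \<open>1\<close>.\<close>

lemma open_prob_eq: "open_prob p = min 1 (max 0 p)"
  by (simp add: bernoulli_pmf.rep_eq)

text \<open>The bound by powers of \<open>9 p\<close> excludes percolation for \<open>p < 1/9\<close>.\<close>

lemma pc_star_pos: "pc_star > 0"
proof -
  have "1 / 9 \<le> pc_star" unfolding pc_star_def
  proof (rule cInf_greatest)
    show "{p \<in> {0..1}. 0 < perc_prob (initial_law p)} \<noteq> {}"
      using perc_prob_one by force
  next
    fix p assume p: "p \<in> {p \<in> {0..1}. 0 < perc_prob (initial_law p)}"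
    show "1 / 9 \<le> p"
    proof (rule ccontr)
      assume "\<not> 1 / 9 \<le> p"
      then have "norm (9 * p) < 1" using p by simp
      then have "(\<lambda>n. (9 * p) ^ n) \<longlonglongrightarrow> 0" by (rule LIMSEQ_power_zero)
      then have "perc_prob (initial_law p) \<le> 0"
        using perc_prob_le[of p] p by (intro LIMSEQ_le_const) auto
      then show False using p by simp
    qed
  qed
  then show ?thesis by simp
qed

lemma eventually_open_prob_ge:
  "\<forall>\<^sub>F p in nhds pc_star. min 1 (pc_star / 2) \<le> open_prob p"
proof -
  have "\<forall>\<^sub>F p in nhds pc_star. pc_star / 2 < p"
    using pc_star_pos by (intro order_tendstoD(1)[OF filterlim_ident]) simp
  then show ?thesis
    by eventually_elim (auto simp: open_prob_eq)
qed


section \<open>Comparable quantities have the same exponents\<close>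

text \<open>The logarithms of \<open>f\<close> and \<open>g\<close> differ by at most \<open>\<bar>ln c\<bar>\<close>, and \<open>h\<close> tends to infinity. Where \<open>f\<close> vanishes,
so does \<open>g\<close>, and the two logarithms agree by the convention \<open>ln 0 = 0\<close>.\<close>

lemma ln_ratio_limit:
  fixes f g h :: "'a \<Rightarrow> real"
  assumes f: "((\<lambda>x. ln (f x) / h x) \<longlongrightarrow> L) F"
    and h: "filterlim h at_infinity F"
    and c: "c > 0"
    and ev: "\<forall>\<^sub>F x in F. 0 \<le> f x \<and> f x \<le> g x \<and> c * g x \<le> f x"
  shows "((\<lambda>x. ln (g x) / h x) \<longlongrightarrow> L) F"
proof -
  have "((\<lambda>x. ln c / h x) \<longlongrightarrow> 0) F"
    using h by (rule tendsto_divide_0[OF tendsto_const])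
  moreover have "\<forall>\<^sub>F x in F. norm (ln (g x) / h x - ln (f x) / h x) \<le> norm (ln c / h x)"
    using ev
  proof eventually_elim
    case (elim x)
    have "\<bar>ln (g x) - ln (f x)\<bar> \<le> \<bar>ln c\<bar>"
    proof (cases "f x = 0")
      case True
      with elim c have "g x = 0"
        by (metis dual_order.antisym mult_le_0_iff not_le)
      with True show ?thesis by simp
    next
      case False
      with elim have pos: "0 < f x" "0 < g x" by auto
      have "ln (f x) \<le> ln (g x)" using elim pos by simp
      moreover have "ln c + ln (g x) \<le> ln (f x)"
        using elim pos c by (metis ln_le_cancel_iff ln_mult_pos mult_pos_pos)
      ultimately show ?thesis by linarith
    qed
    then show ?case
      by (simp add: diff_divide_distrib[symmetric] divide_right_mono)
  qed
  ultimately have "((\<lambda>x. ln (g x) / h x - ln (f x) / h x) \<longlongrightarrow> 0) F"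
    by (rule Lim_null_comparison[rotated, OF tendsto_norm_zero])
  from tendsto_add[OF this f] show ?thesis by simp
qed

lemma ln_diff_at_infinity:
  "filterlim (\<lambda>p::real. ln (p - a)) at_infinity (at_right a)"
  "filterlim (\<lambda>p::real. ln (a - p)) at_infinity (at_left a)"
proof -
  have "filterlim (\<lambda>p. p - a) (at_right 0) (at_right a)"
    unfolding at_right_to_0[of a] by (simp add: filterlim_filtermap filterlim_ident)
  then show "filterlim (\<lambda>p. ln (p - a)) at_infinity (at_right a)"
    by (intro filterlim_mono[OF filterlim_compose[OF ln_at_0] at_bot_le_at_infinity order_refl])
  have "filterlim (\<lambda>p. a - p) (at_right 0) (at_left a)"
  proof (rule filterlim_at_withinI)
    show "((\<lambda>p. a - p) \<longlongrightarrow> 0) (at_left a)" by (auto intro!: tendsto_eq_intros)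
  qed (auto simp: eventually_at_filter)
  then show "filterlim (\<lambda>p. ln (a - p)) at_infinity (at_left a)"
    by (intro filterlim_mono[OF filterlim_compose[OF ln_at_0] at_bot_le_at_infinity order_refl])
qed

lemma site_norm_at_top: "filterlim site_norm at_top at_infinity_site"
  unfolding at_infinity_site_def by (rule filterlim_filtercomap)

lemma connectivity_ratio_limit:
  assumes "open_prob p > 0" "filterlim h at_infinity F"
    and "((\<lambda>x. ln (connectivity (initial_law p) x) / h x) \<longlongrightarrow> L) F"
  shows "((\<lambda>x. ln (connectivity (bootstrapped_law p) x) / h x) \<longlongrightarrow> L) F"
  by (rule ln_ratio_limit[OF assms(3,2), of "(open_prob p)\<^sup>2"])
     (use assms(1) in \<open>auto simp: connectivity_compare, simp add: connectivity_def\<close>)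

text \<open>The rate is the limit of logarithms divided by \<open>- \<parallel>x\<parallel>\<close>, so the constant factor between the
two connectivity functions is invisible to it.\<close>

lemma decay_rate_bootstrapped:
  assumes "open_prob p > 0" "decay_rate_tendsto (initial_law p) l"
  shows "decay_rate_tendsto (bootstrapped_law p) l"
proof -
  have rate: "- (1 / site_norm x) * t = t / - site_norm x" for x t by simp
  have "filterlim (\<lambda>x. - site_norm x) at_infinity at_infinity_site"
    using site_norm_at_top filterlim_uminus_at_top at_bot_le_at_infinity
    by (metis filterlim_mono order_refl)
  from connectivity_ratio_limit[OF assms(1) this] assms(2) show ?thesis
    unfolding decay_rate_tendsto_def rate .
qed

lemma corr_length_bootstrapped:
  assumes "open_prob p > 0" "decay_rate_tendsto (initial_law p) l"
  shows "corr_length (bootstrapped_law p) = corr_length (initial_law p)"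
proof -
  have "(THE l. decay_rate_tendsto M l) = l" if "decay_rate_tendsto M l" for M
    using that by (intro the_equality) (auto intro: decay_rate_unique)
  then show ?thesis
    using assms(2) decay_rate_bootstrapped[OF assms] by (simp add: corr_length_def)
qed

text \<open>The two means are infinite for the same parameters, and then both are sent to \<open>0\<close> by
\<^const>\<open>enn2real\<close>.\<close>

lemma enn2real_mean_cluster_size_compare:
  assumes q: "open_prob p > 0"
  shows "enn2real (mean_cluster_size (initial_law p)) \<le> enn2real (mean_cluster_size (bootstrapped_law p))"
    "(open_prob p)\<^sup>2 * enn2real (mean_cluster_size (bootstrapped_law p))
      \<le> enn2real (mean_cluster_size (initial_law p))"
proof -
  let ?q2 = "(open_prob p)\<^sup>2"
  note le = mean_cluster_size_compare[of p]
  have "enn2real (mean_cluster_size (initial_law p)) \<le> enn2real (mean_cluster_size (bootstrapped_law p)) \<and>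
    ?q2 * enn2real (mean_cluster_size (bootstrapped_law p)) \<le> enn2real (mean_cluster_size (initial_law p))"
  proof (cases "mean_cluster_size (initial_law p) = \<infinity>")
    case True
    with le(1) show ?thesis by (simp add: top_unique)
  next
    case False
    with le(2) q have "mean_cluster_size (bootstrapped_law p) \<noteq> \<infinity>"
      by (auto simp: ennreal_mult_top top_unique)
    with False enn2real_mono[OF le(1)] enn2real_mono[OF le(2)] show ?thesis
      by (simp add: enn2real_mult less_top)
  qed
  then show "enn2real (mean_cluster_size (initial_law p)) \<le> enn2real (mean_cluster_size (bootstrapped_law p))"
    "?q2 * enn2real (mean_cluster_size (bootstrapped_law p)) \<le> enn2real (mean_cluster_size (initial_law p))"
    by simp_all
qed

theorem corollary3p1:
  fixes \<beta> \<eta> \<nu> \<gamma> :: real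
  assumes corr_length_exists:
      "\<forall>\<^sub>F p in at_left pc_star. \<exists>l. decay_rate_tendsto (initial_law p) l"
    and beta: "((\<lambda>p. ln (perc_prob (initial_law p)) / ln (p - pc_star)) \<longlongrightarrow> \<beta>) (at_right pc_star)"
    and eta: "((\<lambda>x. ln (connectivity (initial_law pc_star) x) / ln (site_norm x)) \<longlongrightarrow> - \<eta>)
                at_infinity_site"
    and nu: "((\<lambda>p. ln (corr_length (initial_law p)) / ln (pc_star - p)) \<longlongrightarrow> - \<nu>) (at_left pc_star)"
    and gamma: "((\<lambda>p. ln (enn2real (mean_cluster_size (initial_law p))) / ln (pc_star - p))
                  \<longlongrightarrow> - \<gamma>) (at_left pc_star)"
  shows "((\<lambda>p. ln (perc_prob (bootstrapped_law p)) / ln (p - pc_star)) \<longlongrightarrow> \<beta>) (at_right pc_star)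
    \<and> ((\<lambda>x. ln (connectivity (bootstrapped_law pc_star) x) / ln (site_norm x)) \<longlongrightarrow> - \<eta>)
        at_infinity_site
    \<and> (\<forall>\<^sub>F p in at_left pc_star. \<exists>l. decay_rate_tendsto (bootstrapped_law p) l)
    \<and> ((\<lambda>p. ln (corr_length (bootstrapped_law p)) / ln (pc_star - p)) \<longlongrightarrow> - \<nu>) (at_left pc_star)
    \<and> ((\<lambda>p. ln (enn2real (mean_cluster_size (bootstrapped_law p))) / ln (pc_star - p))
          \<longlongrightarrow> - \<gamma>) (at_left pc_star)"
proof (intro conjI)
  \<comment> \<open>A lower bound on the density that is uniform near the critical value. The minimum with \<open>1\<close>
    accounts for the truncation of the Bernoulli parameter.\<close>
  define c where "c = min 1 (pc_star / 2)"
  have c: "c > 0" using pc_star_pos by (simp add: c_def)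
  have near: "\<forall>\<^sub>F p in at pc_star within S. c \<le> open_prob p" for S
    unfolding c_def by (rule filter_leD[OF at_within_le_nhds eventually_open_prob_ge])
  show "((\<lambda>p. ln (perc_prob (bootstrapped_law p)) / ln (p - pc_star)) \<longlongrightarrow> \<beta>) (at_right pc_star)"
  proof (rule ln_ratio_limit[OF beta ln_diff_at_infinity(1) c])
    show "\<forall>\<^sub>F p in at_right pc_star. 0 \<le> perc_prob (initial_law p)
        \<and> perc_prob (initial_law p) \<le> perc_prob (bootstrapped_law p)
        \<and> c * perc_prob (bootstrapped_law p) \<le> perc_prob (initial_law p)"
      using near
    proof eventually_elim
      case (elim p)
      have "c * perc_prob (bootstrapped_law p) \<le> open_prob p * perc_prob (bootstrapped_law p)"
        using elim by (intro mult_right_mono) (simp_all add: perc_prob_def)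
      then show ?case using perc_prob_compare[of p] by (auto simp: perc_prob_def[of "initial_law p"])
    qed
  qed
  show "((\<lambda>x. ln (connectivity (bootstrapped_law pc_star) x) / ln (site_norm x)) \<longlongrightarrow> - \<eta>) at_infinity_site"
  proof (rule connectivity_ratio_limit[OF _ _ eta])
    show "0 < open_prob pc_star"
      using pc_star_pos by (simp add: open_prob_eq)
    show "filterlim (\<lambda>x. ln (site_norm x)) at_infinity at_infinity_site"
      by (rule filterlim_mono[OF filterlim_compose[OF ln_at_top site_norm_at_top] at_top_le_at_infinity order_refl])
  qed
  show "\<forall>\<^sub>F p in at_left pc_star. \<exists>l. decay_rate_tendsto (bootstrapped_law p) l"
    using corr_length_exists near
    by eventually_elim (use c in \<open>blast intro: decay_rate_bootstrapped order_less_le_trans\<close>)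
  have "\<forall>\<^sub>F p in at_left pc_star. ln (corr_length (initial_law p)) / ln (pc_star - p)
      = ln (corr_length (bootstrapped_law p)) / ln (pc_star - p)"
    using corr_length_exists near
  proof eventually_elim
    case (elim p)
    then obtain l where "decay_rate_tendsto (initial_law p) l" by blast
    with elim c corr_length_bootstrapped[of p l] show ?case by simp
  qed
  with nu show "((\<lambda>p. ln (corr_length (bootstrapped_law p)) / ln (pc_star - p)) \<longlongrightarrow> - \<nu>) (at_left pc_star)"
    by (rule Lim_transform_eventually)
  show "((\<lambda>p. ln (enn2real (mean_cluster_size (bootstrapped_law p))) / ln (pc_star - p))
      \<longlongrightarrow> - \<gamma>) (at_left pc_star)"
  proof (rule ln_ratio_limit[OF gamma ln_diff_at_infinity(2)])
    show "0 < c\<^sup>2" using c by simp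
    show "\<forall>\<^sub>F p in at_left pc_star. 0 \<le> enn2real (mean_cluster_size (initial_law p))
        \<and> enn2real (mean_cluster_size (initial_law p)) \<le> enn2real (mean_cluster_size (bootstrapped_law p))
        \<and> c\<^sup>2 * enn2real (mean_cluster_size (bootstrapped_law p)) \<le> enn2real (mean_cluster_size (initial_law p))"
      using near
    proof eventually_elim
      case (elim p)
      have "c\<^sup>2 * enn2real (mean_cluster_size (bootstrapped_law p))
          \<le> (open_prob p)\<^sup>2 * enn2real (mean_cluster_size (bootstrapped_law p))"
        using elim c by (intro mult_right_mono power_mono) simp_all
      then show ?case using enn2real_mean_cluster_size_compare[of p] elim c by auto
    qed
  qed
qed

end
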